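(* Suppose $m\equiv 4 \pmod{12}$ is a positive integer, $Q$ is a prime power such that $Q\ge m+1$, and $n$ is an integer with $m/2\le n\le m(m-1)/12$. Then there exists a $(2,n,4)$-RTS with restricted repairability, with shares from $(\mathbb{F}_Q)^4$, having information rate $3/4$ and communication complexity $4/3$.
   Context: Threshold schemes. For $2\le k\le n$, a $(k,n)$-threshold scheme is a (randomized) method by which a dealer chooses a secret from a finite set $\mathcal{K}$ and gives a share, from a finite set $\mathcal{S}$ of possible shares, to each of $n$ players $P_1,\dots,P_n$, such that any $k$ players can compute the secret from their shares, and no $k-1$ players obtain any information about the secret (unconditionally: the distribution of their shares does not depend on the secret). Its information rate is $\log_2|\mathcal{K}|/\log_2|\mathcal{S}|$. Repairing. A repairing protocol lets a player $P_\ell$ who lost their share recover exactly that share, without the dealer, with help from a set of $d$ other players (not all of whom need actually send anything; $d$ is the repairing degree), over secure pairwise channels. It has two phases. In the message exchange phase (possibly empty) each of the $d$ players, using their own share and private randomness, simultaneously sends at most one message to each other member of the set. In the repairing phase the $d$ players each send a message to $P_\ell$ (depending on their share, randomness and the messages received), from which $P_\ell$ computes the lost share. Security: all players follow the protocol honestly, and for every coalition of $k-1$ players (which may or may not include $P_\ell$), the shares of the coalition together with all messages its members sent or received in the execution of the protocol give no information about the secret. A $(k,n)$-threshold scheme with such a secure protocol with repairing degree $d$ is a $(k,n,d)$-RTS (repairable threshold scheme). It has restricted repairability if for every player there exists a set of $d$ other players who can repair that player's share. The communication complexity of a repairing protocol is the sum of the bit-lengths of all messages transmitted divided by the bit-length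 of the secret (an element of a set of size $N$ has bit-length $\log_2 N$). *)

theory Defs
  imports
    "HOL-Analysis.Finite_Cartesian_Product"
    "HOL-Library.Numeral_Type"
    "HOL-Number_Theory.Prime_Powers"
    "HOL-Number_Theory.Cong"
    "HOL-Probability.Product_PMF"
begin

text \<open>
  The players are \<open>{1..n}\<close>. The dealer is a map that sends a secret to the joint distribution of the
  shares of all players. Sets of players see \<open>restrict sh A\<close>, which is \<open>undefined\<close> off \<open>A\<close>, so a
  function of it depends on the shares of the members of \<open>A\<close> only.
\<close>

definition threshold_scheme ::
  "nat \<Rightarrow> nat \<Rightarrow> 'k set \<Rightarrow> 's set \<Rightarrow> ('k \<Rightarrow> (nat \<Rightarrow> 's) pmf) \<Rightarrow> bool" where
  "threshold_scheme k n K S deal \<longleftrightarrow>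
     2 \<le> k \<and> k \<le> n \<and> finite K \<and> K \<noteq> {} \<and> finite S \<and>
     (\<forall>s\<in>K. \<forall>sh\<in>set_pmf (deal s). \<forall>i\<in>{1..n}. sh i \<in> S) \<and>
     (\<forall>A. A \<subseteq> {1..n} \<and> card A = k \<longrightarrow>
        (\<exists>reconstruct. \<forall>s\<in>K. \<forall>sh\<in>set_pmf (deal s). reconstruct (restrict sh A) = s)) \<and>
     (\<forall>A. A \<subseteq> {1..n} \<and> card A = k - 1 \<longrightarrow>
        (\<forall>s\<in>K. \<forall>s'\<in>K. map_pmf (\<lambda>sh. restrict sh A) (deal s) =
                       map_pmf (\<lambda>sh. restrict sh A) (deal s')))"

definition bit_length :: "'a set \<Rightarrow> real" where
  "bit_length X = log 2 (real (card X))"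

definition information_rate :: "'k set \<Rightarrow> 's set \<Rightarrow> real" where
  "information_rate K S = bit_length K / bit_length S"

text \<open>
  \<open>coins P i\<close> is the distribution of the private randomness of player \<open>i\<close>.
  \<open>exchange P i j x r\<close> is what \<open>i\<close>, with share \<open>x\<close> and randomness \<open>r\<close>, sends to \<open>j\<close> in the message
  exchange phase, and \<open>reply P i x r f\<close> is what \<open>i\<close> sends to the player being repaired if \<open>f j\<close> is
  what it received from \<open>j\<close>. The value \<open>None\<close> means that no message is sent.
\<close>

record ('s, 'r, 'm) repair_protocol =
  coins :: "nat \<Rightarrow> 'r pmf"
  exchange :: "nat \<Rightarrow> nat \<Rightarrow> 's \<Rightarrow> 'r \<Rightarrow> 'm option"
  reply :: "nat \<Rightarrow> 's \<Rightarrow> 'r \<Rightarrow> (nat \<Rightarrow> 'm option) \<Rightarrow> 'm option"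
  recover :: "(nat \<Rightarrow> 'm option) \<Rightarrow> 's"

text \<open>
  In what follows \<open>l\<close> is the player being repaired, \<open>D\<close> is the set of helping players, and
  \<open>sh i\<close> and \<open>w i\<close> are the share and the randomness of player \<open>i\<close>. A channel is a pair
  (sender, recipient); it is used once, for the reply if the recipient is \<open>l\<close> and for the message
  exchange otherwise.
\<close>

definition channels :: "nat \<Rightarrow> nat set \<Rightarrow> (nat \<times> nat) set" where
  "channels l D = {(i, j). i \<in> D \<and> j \<in> insert l D \<and> i \<noteq> j}"

definition exchange_msg ::
  "('s, 'r, 'm) repair_protocol \<Rightarrow> (nat \<Rightarrow> 's) \<Rightarrow> (nat \<Rightarrow> 'r) \<Rightarrow> nat \<Rightarrow> nat \<Rightarrow> 'm option" where
  "exchange_msg P sh w i j = exchange P i j (sh i) (w i)"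

definition reply_msg ::
  "('s, 'r, 'm) repair_protocol \<Rightarrow> nat set \<Rightarrow> (nat \<Rightarrow> 's) \<Rightarrow> (nat \<Rightarrow> 'r) \<Rightarrow> nat \<Rightarrow> 'm option" where
  "reply_msg P D sh w i =
     reply P i (sh i) (w i) (restrict (\<lambda>j. exchange_msg P sh w j i) (D - {i}))"

definition repaired_share ::
  "('s, 'r, 'm) repair_protocol \<Rightarrow> nat set \<Rightarrow> (nat \<Rightarrow> 's) \<Rightarrow> (nat \<Rightarrow> 'r) \<Rightarrow> 's" where
  "repaired_share P D sh w = recover P (restrict (reply_msg P D sh w) D)"

definition channel_msg ::
  "('s, 'r, 'm) repair_protocol \<Rightarrow> nat \<Rightarrow> nat set \<Rightarrow> (nat \<Rightarrow> 's) \<Rightarrow> (nat \<Rightarrow> 'r) \<Rightarrow>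
   nat \<times> nat \<Rightarrow> 'm option" where
  "channel_msg P l D sh w =
     (\<lambda>(i, j). if j = l then reply_msg P D sh w i else exchange_msg P sh w i j)"

definition coalition_view ::
  "('s, 'r, 'm) repair_protocol \<Rightarrow> nat \<Rightarrow> nat set \<Rightarrow> nat set \<Rightarrow> (nat \<Rightarrow> 's) \<Rightarrow> (nat \<Rightarrow> 'r) \<Rightarrow>
   (nat \<Rightarrow> 's) \<times> (nat \<times> nat \<Rightarrow> 'm option)" where
  "coalition_view P l D A sh w =
     (restrict sh A,
      restrict (channel_msg P l D sh w) {(i, j). (i, j) \<in> channels l D \<and> (i \<in> A \<or> j \<in> A)})"

definition execution ::
  "('k \<Rightarrow> (nat \<Rightarrow> 's) pmf) \<Rightarrow> ('s, 'r, 'm) repair_protocol \<Rightarrow> nat set \<Rightarrow> 'k \<Rightarrow>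
   ((nat \<Rightarrow> 's) \<times> (nat \<Rightarrow> 'r)) pmf" where
  "execution deal P D s = pair_pmf (deal s) (Pi_pmf D undefined (coins P))"

text \<open>
  The set of all values that can occur on a channel. If a player is sometimes silent, \<open>None\<close> is one
  of these values, so silence cannot carry information free of charge; a channel on which nothing is
  ever sent has the one value \<open>None\<close>, hence bit length \<open>0\<close>.
\<close>

definition possible_msgs ::
  "'k set \<Rightarrow> ('k \<Rightarrow> (nat \<Rightarrow> 's) pmf) \<Rightarrow> ('s, 'r, 'm) repair_protocol \<Rightarrow> nat \<Rightarrow> nat set \<Rightarrow>
   nat \<times> nat \<Rightarrow> 'm option set" where
  "possible_msgs K deal P l D c =
     {channel_msg P l D sh w c | s sh w. s \<in> K \<and> (sh, w) \<in> set_pmf (execution deal P D s)}"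

text \<open>
  The message sets have to be finite, since \<open>card\<close> and hence \<open>bit_length\<close> would be \<open>0\<close> on an
  infinite one.
\<close>

definition secure_repairing_protocol ::
  "nat \<Rightarrow> nat \<Rightarrow> 'k set \<Rightarrow> ('k \<Rightarrow> (nat \<Rightarrow> 's) pmf) \<Rightarrow> nat \<Rightarrow> nat set \<Rightarrow>
   ('s, 'r, 'm) repair_protocol \<Rightarrow> bool" where
  "secure_repairing_protocol k n K deal l D P \<longleftrightarrow>
     (\<forall>c\<in>channels l D. finite (possible_msgs K deal P l D c)) \<and>
     (\<forall>s\<in>K. \<forall>(sh, w)\<in>set_pmf (execution deal P D s). repaired_share P D sh w = sh l) \<and>
     (\<forall>A. A \<subseteq> {1..n} \<and> card A = k - 1 \<longrightarrow>
        (\<forall>s\<in>K. \<forall>s'\<in>K.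
           map_pmf (\<lambda>(sh, w). coalition_view P l D A sh w) (execution deal P D s) =
           map_pmf (\<lambda>(sh, w). coalition_view P l D A sh w) (execution deal P D s')))"

definition communication_complexity ::
  "'k set \<Rightarrow> ('k \<Rightarrow> (nat \<Rightarrow> 's) pmf) \<Rightarrow> nat \<Rightarrow> nat set \<Rightarrow> ('s, 'r, 'm) repair_protocol \<Rightarrow> real" where
  "communication_complexity K deal l D P =
     (\<Sum>c\<in>channels l D. bit_length (possible_msgs K deal P l D c)) / bit_length K"

text \<open>
  A \<open>(k, n, d)\<close>-RTS with restricted repairability: for each player \<open>l\<close>, the \<open>d\<close> players \<open>helpers l\<close>
  repair the share of \<open>l\<close> by the protocol \<open>prot l\<close>.
\<close>

definition restricted_RTS ::
  "nat \<Rightarrow> nat \<Rightarrow> nat \<Rightarrow> 'k set \<Rightarrow> 's set \<Rightarrow> ('k \<Rightarrow> (nat \<Rightarrow> 's) pmf) \<Rightarrow>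
   (nat \<Rightarrow> nat set) \<Rightarrow> (nat \<Rightarrow> ('s, 'r, 'm) repair_protocol) \<Rightarrow> bool" where
  "restricted_RTS k n d K S deal helpers prot \<longleftrightarrow>
     threshold_scheme k n K S deal \<and>
     (\<forall>l\<in>{1..n}. helpers l \<subseteq> {1..n} - {l} \<and> card (helpers l) = d \<and>
        secure_repairing_protocol k n K deal l (helpers l) (prot l))"

end

theory Submission imports Defs begin

text \<open>
  No resolvable designs are needed. The secret is a word \<open>c\<close> of the parity code in \<open>F\<^sup>4\<close>, player \<open>i\<close>
  has a public word \<open>w i\<close>, and coordinate \<open>j\<close> of its share is \<open>u\<^sub>j + w i j * c\<^sub>j\<close> with a common
  uniformly random \<open>u\<close>. One share is uniform whatever \<open>c\<close> is; if two public words agree in at most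
  one coordinate, two shares determine all but one coordinate of \<open>c\<close>, hence \<open>c\<close>. A player whose
  public word has the same symbol in coordinate \<open>j\<close> holds the same coordinate \<open>j\<close> of the share and
  can send it, which reveals nothing to the recipient beyond the repaired share. So it suffices to
  find \<open>n\<close> words of length \<open>4\<close> over \<open>F\<close>, pairwise agreeing at most once, such that every symbol that
  occurs in a coordinate occurs there at least twice.
\<close>

section \<open>The parity code: its size, and recovery of a missing coordinate\<close>

definition parity_code :: "('f::{field, finite} ^ 'j::finite) set" where
  "parity_code = {c. (\<Sum>j\<in>UNIV. c $ j) = 0}"

text \<open>Changing one fixed coordinate \<open>a\<close> moves the coordinate sum through the
  whole field, so every word is uniquely a codeword plus a multiple of the unit vector at
  \<open>a\<close>.\<close>

lemma card_parity_code:
  "card (parity_code :: ('f::{field, finite} ^ 'j::finite) set) = CARD('f) ^ (CARD('j) - 1)"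
proof -
  obtain a :: 'j where True by blast
  have "bij_betw (\<lambda>(t, c). c + axis a t) (UNIV \<times> parity_code) (UNIV :: ('f ^ 'j) set)"
  proof (rule bij_betw_byWitness[where f' = "\<lambda>c. (\<Sum>j\<in>UNIV. c $ j, c - axis a (\<Sum>j\<in>UNIV. c $ j))"])
  qed (auto simp: parity_code_def sum.distrib sum_subtractf axis_def vec_eq_iff)
  hence "CARD('f) * card (parity_code :: ('f ^ 'j) set) = CARD('f ^ 'j)"
    by (auto dest!: bij_betw_same_card simp: card_cartesian_product)
  also have "\<dots> = CARD('f) * CARD('f) ^ (CARD('j) - 1)"
    by (simp flip: power_Suc)
  finally show ?thesis by simp
qed

lemma parity_code_eqI:
  assumes "c \<in> parity_code" "c' \<in> parity_code" "\<And>j. j \<noteq> a \<Longrightarrow> c $ j = c' $ j"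
  shows "c = c'"
proof -
  have "c $ a + (\<Sum>j\<in>UNIV - {a}. c $ j) = 0" "c' $ a + (\<Sum>j\<in>UNIV - {a}. c' $ j) = 0"
    using assms(1,2) by (auto simp: parity_code_def sum.remove[of UNIV a])
  moreover have "(\<Sum>j\<in>UNIV - {a}. c $ j) = (\<Sum>j\<in>UNIV - {a}. c' $ j)"
    using assms(3) by (intro sum.cong) auto
  ultimately have "c $ a = c' $ a"
    by (metis add_right_cancel)
  thus ?thesis using assms(3) by (metis vec_eq_iff)
qed

lemma bit_length_power:
  assumes "card X = b ^ e" "b > 0"
  shows "bit_length X = real e * log 2 (real b)"
  using assms by (simp add: bit_length_def log_nat_power)

section \<open>The threshold scheme given by public words, and its repairing protocol\<close>

locale word_scheme =
  fixes n :: nat and w :: "nat \<Rightarrow> 'j::finite \<Rightarrow> 'f::{field, finite}"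
    and helper :: "nat \<Rightarrow> 'j \<Rightarrow> nat"
    and K :: "nat set" and codeword :: "nat \<Rightarrow> 'f ^ 'j" and enc :: "'f \<Rightarrow> nat"
  assumes n_ge_2: "2 \<le> n"
    and agree_once: "\<lbrakk>p \<in> {1..n}; q \<in> {1..n}; p \<noteq> q; w p j = w q j; w p k = w q k\<rbrakk> \<Longrightarrow> j = k"
    and helper_range: "l \<in> {1..n} \<Longrightarrow> helper l j \<in> {1..n} - {l}"
    and helper_agrees: "l \<in> {1..n} \<Longrightarrow> w (helper l j) j = w l j"
    and bij_codeword: "bij_betw codeword K parity_code"
    and inj_enc: "inj enc"
begin

definition share :: "nat \<Rightarrow> 'f ^ 'j \<Rightarrow> nat \<Rightarrow> 'f ^ 'j" where
  "share s u i = (\<chi> j. u $ j + w i j * codeword s $ j)"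

definition deal :: "nat \<Rightarrow> (nat \<Rightarrow> 'f ^ 'j) pmf" where
  "deal s = map_pmf (share s) (pmf_of_set UNIV)"

text \<open>Tells a helper which coordinate of its share to send; the inverse makes sense by
  \<open>inj_helper\<close>.\<close>

definition helper_coord :: "nat \<Rightarrow> nat \<Rightarrow> 'j" where
  "helper_coord l = the_inv (helper l)"

definition prot :: "nat \<Rightarrow> ('f ^ 'j, nat, nat) repair_protocol" where
  "prot l = \<lparr>coins = \<lambda>_. return_pmf 0, exchange = \<lambda>_ _ _ _. None,
     reply = \<lambda>i x _ _. Some (enc (x $ helper_coord l i)),
     recover = \<lambda>f. \<chi> j. inv enc (the (f (helper l j)))\<rparr>"

text \<open>A helper serving two coordinates would agree with \<open>l\<close> in both, against
  \<open>agree_once\<close>.\<close>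

lemma inj_helper: "l \<in> {1..n} \<Longrightarrow> inj (helper l)"
proof (rule injI)
  fix j k assume l: "l \<in> {1..n}" and eq: "helper l j = helper l k"
  show "j = k"
    using agree_once[of "helper l j" l j k] helper_range[OF l, of j] helper_agrees[OF l, of j]
      helper_agrees[OF l, of k] l eq by auto
qed

lemma helper_coord_helper [simp]: "l \<in> {1..n} \<Longrightarrow> helper_coord l (helper l j) = j"
  by (simp add: helper_coord_def the_inv_f_f inj_helper)

lemma set_pmf_deal: "set_pmf (deal s) = range (share s)"
  by (simp add: deal_def)

lemma card_K: "card K = CARD('f) ^ (CARD('j) - 1)"
  using bij_betw_same_card[OF bij_codeword] by (simp add: card_parity_code)

lemma finite_K: "finite K" and K_nonempty: "K \<noteq> {}"
  using card_K by (auto intro: card_ge_0_finite)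

lemma card_range_helper: "l \<in> {1..n} \<Longrightarrow> card (range (helper l)) = CARD('j)"
  using card_image[OF inj_helper] by blast

text \<open>Reconstruction: where the public words differ, subtracting the two shares cancels the
  mask and determines that coordinate of the codeword. At most one coordinate is left, and the
  parity check fixes it.\<close>

lemma share_inj:
  assumes "p \<in> {1..n}" "q \<in> {1..n}" "p \<noteq> q" "s \<in> K" "s' \<in> K"
    and "share s u p = share s' u' p" "share s u q = share s' u' q"
  shows "s = s'"
proof -
  have eq: "codeword s $ j = codeword s' $ j" if "w p j \<noteq> w q j" for j
  proof -
    have "u $ j + w p j * codeword s $ j = u' $ j + w p j * codeword s' $ j"
      "u $ j + w q j * codeword s $ j = u' $ j + w q j * codeword s' $ j"
      using assms(6,7) by (simp_all add: share_def vec_eq_iff)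
    hence "(w p j - w q j) * (codeword s $ j - codeword s' $ j) = 0"
      by algebra
    thus ?thesis using that by simp
  qed
  \<comment> \<open>\<open>a\<close> is the coordinate of agreement, or any coordinate if the words
    agree nowhere.\<close>
  obtain a where "\<And>j. j \<noteq> a \<Longrightarrow> w p j \<noteq> w q j"
    using agree_once[OF assms(1-3)] by metis
  moreover have "codeword s \<in> parity_code" "codeword s' \<in> parity_code"
    using bij_codeword assms(4,5) by (auto simp: bij_betw_def)
  ultimately have "codeword s = codeword s'"
    using eq by (intro parity_code_eqI) auto
  thus ?thesis using bij_codeword assms(4,5) by (auto simp: bij_betw_def inj_on_def)
qed

text \<open>A one-time pad: for a fixed secret, a single share is a translate of the uniform
  mask.\<close>

lemma deal_marginal: "map_pmf (\<lambda>sh. sh i) (deal s) = pmf_of_set UNIV"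
proof -
  have "bij (\<lambda>u. share s u i)"
    by (rule o_bij[where g = "\<lambda>x. \<chi> j. x $ j - w i j * codeword s $ j"])
      (auto simp: share_def fun_eq_iff vec_eq_iff)
  thus ?thesis
    by (simp add: deal_def pmf.map_comp o_def map_pmf_of_set_bij_betw)
qed

lemma threshold_scheme_deal: "threshold_scheme 2 n K (UNIV :: ('f ^ 'j) set) deal"
proof -
  have "\<exists>reconstruct. \<forall>s\<in>K. \<forall>sh\<in>set_pmf (deal s). reconstruct (restrict sh A) = s"
    if A: "A \<subseteq> {1..n}" "card A = 2" for A
  proof -
    obtain p q where pq: "A = {p, q}" "p \<noteq> q"
      using A(2) by (auto simp: card_2_iff)
    \<comment> \<open>The description is well defined by \<open>share_inj\<close>: two shares fit
      only one secret.\<close>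
    define rec where "rec f = (THE s. s \<in> K \<and> (\<exists>u. f = restrict (share s u) A))" for f
    have "rec (restrict sh A) = s" if s: "s \<in> K" "sh \<in> set_pmf (deal s)" for s sh
    proof -
      obtain u where u: "sh = share s u" using s(2) by (auto simp: set_pmf_deal)
      show ?thesis
        unfolding rec_def
      proof (rule the_equality)
        fix t assume "t \<in> K \<and> (\<exists>u. restrict sh A = restrict (share t u) A)"
        then obtain v where t: "t \<in> K" "restrict sh A = restrict (share t v) A" by blast
        have "sh p = share t v p" "sh q = share t v q"
          using fun_cong[OF t(2), of p] fun_cong[OF t(2), of q] pq by auto
        thus "t = s" using share_inj[of p q t s v u] A(1) pq s(1) t(1) u by auto
      qed (use s u in auto)
    qed
    thus ?thesis by blast
  qed
  moreover have "map_pmf (\<lambda>sh. restrict sh A) (deal s) = map_pmf (\<lambda>sh. restrict sh A) (deal s')"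
    if A: "card A = 2 - 1" for A s s'
  proof -
    have "card A = 1" using A by simp
    then obtain p where p: "A = {p}" by (rule card_1_singletonE)
    have "map_pmf (\<lambda>sh. restrict sh A) (deal s) =
        map_pmf (\<lambda>x. restrict (\<lambda>_. x) A) (map_pmf (\<lambda>sh. sh p) (deal s))" for s
      by (auto simp: pmf.map_comp o_def p fun_eq_iff intro!: map_pmf_cong)
    thus ?thesis by (simp only: deal_marginal)
  qed
  ultimately show ?thesis
    using n_ge_2 finite_K K_nonempty unfolding threshold_scheme_def by auto
qed

lemma share_helper: "l \<in> {1..n} \<Longrightarrow> share s u (helper l j) $ j = share s u l $ j"
  by (simp add: share_def helper_agrees)

lemma channel_msg_prot:
  "channel_msg (prot l) l D sh r (i, j) = (if j = l then Some (enc (sh i $ helper_coord l i)) else None)"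
  by (simp add: channel_msg_def reply_msg_def exchange_msg_def prot_def)

lemma possible_msgs_prot:
  "possible_msgs K deal (prot l) l D (i, j) = (if j = l then range (\<lambda>x. Some (enc x)) else {None})"
proof -
  obtain s where s: "s \<in> K" using K_nonempty by blast
  obtain r where r: "r \<in> set_pmf (Pi_pmf D undefined (coins (prot l)))"
    using set_pmf_not_empty[of "Pi_pmf D undefined (coins (prot l))"] by auto
  have mem: "channel_msg (prot l) l D (share s u) r c \<in> possible_msgs K deal (prot l) l D c" for u c
  proof -
    have "(share s u, r) \<in> set_pmf (execution deal (prot l) D s)"
      using r by (simp add: execution_def set_pmf_deal)
    thus ?thesis using s unfolding possible_msgs_def by blast
  qed
  show ?thesis
  proof (cases "j = l")
    case True
    have "Some (enc x) \<in> possible_msgs K deal (prot l) l D (i, j)" for x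
      using mem[of "\<chi> k. x - w i k * codeword s $ k" "(i, j)"] True
      by (simp add: channel_msg_prot share_def)
    thus ?thesis
      using True by (auto simp: possible_msgs_def channel_msg_prot)
  next
    case False
    thus ?thesis
      using mem[of 0 "(i, j)"] by (auto simp: possible_msgs_def channel_msg_prot)
  qed
qed

lemma secure_prot:
  assumes l: "l \<in> {1..n}"
  shows "secure_repairing_protocol 2 n K deal l (range (helper l)) (prot l)"
proof -
  let ?D = "range (helper l)"
  have repaired: "repaired_share (prot l) ?D sh r = sh l"
    if sh: "(sh, r) \<in> set_pmf (execution deal (prot l) ?D s)" for s sh r
  proof -
    obtain u where "sh = share s u"
      using sh by (auto simp: execution_def set_pmf_deal)
    thus ?thesis
      using l inj_enc
      by (simp add: repaired_share_def reply_msg_def prot_def share_helper vec_eq_iff)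
  qed
  have view: "map_pmf (\<lambda>(sh, r). coalition_view (prot l) l ?D A sh r) (execution deal (prot l) ?D s) =
     map_pmf (\<lambda>(sh, r). coalition_view (prot l) l ?D A sh r) (execution deal (prot l) ?D s')"
    if A: "card A = 2 - 1" for A s s'
  proof -
    have "card A = 1" using A by simp
    then obtain p where p: "A = {p}" by (rule card_1_singletonE)
    let ?C = "{(i, j). (i, j) \<in> channels l ?D \<and> (i \<in> A \<or> j \<in> A)}"
    \<comment> \<open>The whole view of the single coalition member, simulated from its share
      \<open>x\<close> alone. As that share is uniform for every secret, so is the distribution of
      the view the same for every secret.\<close>
    define view where "view x = (restrict (\<lambda>_. x) A,
        restrict (\<lambda>(i, j). if j = l then Some (enc (x $ helper_coord l i)) else None) ?C)" for x
    have *: "coalition_view (prot l) l ?D A sh r = view (sh p)"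
      if sh: "sh \<in> set_pmf (deal s)" for s sh r
    proof -
      obtain u where u: "sh = share s u" using sh by (auto simp: set_pmf_deal)
      \<comment> \<open>If \<open>p = l\<close>, the symbols received are coordinates of its own
        share by \<open>share_helper\<close>; otherwise the only reply that \<open>p\<close> sees is
        its own.\<close>
      have "channel_msg (prot l) l ?D sh r (i, j) =
          (if j = l then Some (enc (sh p $ helper_coord l i)) else None)"
        if "(i, j) \<in> ?C" for i j
        using that p l by (auto simp: channel_msg_prot channels_def u share_helper)
      thus ?thesis
        by (auto simp: coalition_view_def view_def p fun_eq_iff restrict_def)
    qed
    have "map_pmf (\<lambda>(sh, r). coalition_view (prot l) l ?D A sh r) (execution deal (prot l) ?D s) =
        map_pmf view (pmf_of_set UNIV)" for s
    proof -
      have "map_pmf (\<lambda>(sh, r). coalition_view (prot l) l ?D A sh r) (execution deal (prot l) ?D s) =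
          map_pmf (\<lambda>x. view (fst x p)) (execution deal (prot l) ?D s)"
        by (rule map_pmf_cong) (auto simp: execution_def *)
      also have "\<dots> = map_pmf view (map_pmf (\<lambda>sh. sh p) (map_pmf fst (execution deal (prot l) ?D s)))"
        by (simp only: pmf.map_comp o_def)
      also have "\<dots> = map_pmf view (pmf_of_set UNIV)"
        by (simp only: execution_def map_fst_pair_pmf deal_marginal)
      finally show ?thesis .
    qed
    thus ?thesis by simp
  qed
  have "finite (possible_msgs K deal (prot l) l ?D c)" for c
    by (cases c) (simp add: possible_msgs_prot)
  thus ?thesis
    using repaired view unfolding secure_repairing_protocol_def by blast
qed

lemma restricted_RTS_prot:
  "restricted_RTS 2 n CARD('j) K (UNIV :: ('f ^ 'j) set) deal (\<lambda>l. range (helper l)) prot"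
  unfolding restricted_RTS_def
proof (intro conjI ballI)
  fix l assume l: "l \<in> {1..n}"
  show "range (helper l) \<subseteq> {1..n} - {l}" using helper_range[OF l] by auto
qed (fact threshold_scheme_deal card_range_helper secure_prot)+

lemma log_card_field_neq_0: "log 2 (real CARD('f)) \<noteq> 0"
proof -
  have "CARD('f) \<ge> card {0, 1 :: 'f}" by (rule card_mono) auto
  hence "log 2 (real CARD('f)) > 0" by simp
  thus ?thesis by linarith
qed

lemma bit_length_secret: "bit_length K = real (CARD('j) - 1) * log 2 (real CARD('f))"
  using card_K by (intro bit_length_power) auto

lemma information_rate_deal:
  "information_rate K (UNIV :: ('f ^ 'j) set) = real (CARD('j) - 1) / real CARD('j)"
proof -
  have "bit_length (UNIV :: ('f ^ 'j) set) = real CARD('j) * log 2 (real CARD('f))"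
    by (intro bit_length_power) auto
  thus ?thesis
    using log_card_field_neq_0 by (simp add: information_rate_def bit_length_secret)
qed

lemma communication_complexity_prot:
  assumes l: "l \<in> {1..n}"
  shows "communication_complexity K deal l (range (helper l)) (prot l) =
    real CARD('j) / real (CARD('j) - 1)"
proof -
  let ?D = "range (helper l)"
  let ?b = "\<lambda>c. bit_length (possible_msgs K deal (prot l) l ?D c)"
  \<comment> \<open>Channels between helpers only ever carry \<open>None\<close>, so their bit
    length is \<open>log 2 1 = 0\<close>.\<close>
  have "(\<Sum>c\<in>channels l ?D. ?b c) = (\<Sum>c\<in>?D \<times> {l}. ?b c)"
  proof (rule sum.mono_neutral_right)
    show "finite (channels l ?D)"
      by (rule finite_subset[of _ "?D \<times> insert l ?D"]) (auto simp: channels_def)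
    show "?D \<times> {l} \<subseteq> channels l ?D"
      using helper_range[OF l] by (fastforce simp: channels_def)
  qed (auto simp: channels_def possible_msgs_prot bit_length_def split: if_splits)
  also have "\<dots> = (\<Sum>c\<in>?D \<times> {l}. log 2 (real CARD('f)))"
  proof (rule sum.cong[OF refl])
    fix c assume "c \<in> ?D \<times> {l}"
    moreover have "card ((\<lambda>x. Some (enc x)) ` UNIV) = CARD('f)"
      by (rule card_image) (use inj_enc in \<open>auto simp: inj_on_def\<close>)
    ultimately show "?b c = log 2 (real CARD('f))"
      by (auto simp: possible_msgs_prot bit_length_def)
  qed
  also have "\<dots> = real CARD('j) * log 2 (real CARD('f))"
    using card_range_helper[OF l] by (simp add: card_cartesian_product)
  finally show ?thesis
    using log_card_field_neq_0 by (simp add: communication_complexity_def bit_length_secret)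
qed

end

section \<open>Families of words that agree at most once and repeat every symbol\<close>

definition repairable_family :: "'i set \<Rightarrow> ('i \<Rightarrow> 'j \<Rightarrow> 'a) \<Rightarrow> bool" where
  "repairable_family I w \<longleftrightarrow>
     (\<forall>p\<in>I. \<forall>q\<in>I. p \<noteq> q \<longrightarrow> (\<forall>j k. w p j = w q j \<longrightarrow> w p k = w q k \<longrightarrow> j = k)) \<and>
     (\<forall>p\<in>I. \<forall>j. \<exists>q\<in>I - {p}. w q j = w p j)"

text \<open>Lets a family be built over convenient indices, symbols and coordinates and then be
  carried over to the players, the field and the type \<open>4\<close>.\<close>

lemma repairable_family_transfer:
  assumes fam: "repairable_family I w"
    and h: "bij_betw h J I" and f: "inj_on f A" and g: "inj g"
    and A: "\<And>p j. p \<in> I \<Longrightarrow> w p j \<in> A"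
  shows "repairable_family J (\<lambda>p j. f (w (h p) (g j)))"
proof -
  have mem: "h p \<in> I" if "p \<in> J" for p
    using h that by (auto simp: bij_betw_def)
  have eq: "f (w p j) = f (w q k) \<longleftrightarrow> w p j = w q k" if "p \<in> I" "q \<in> I" for p q j k
    using inj_on_eq_iff[OF f] A that by auto
  show ?thesis
    unfolding repairable_family_def
  proof (intro conjI ballI impI allI)
    fix p q j k
    assume "p \<in> J" "q \<in> J" "p \<noteq> q"
      "f (w (h p) (g j)) = f (w (h q) (g j))" "f (w (h p) (g k)) = f (w (h q) (g k))"
    moreover from this have "h p \<noteq> h q"
      using h by (auto simp: bij_betw_def inj_on_eq_iff)
    ultimately have "g j = g k"
      using fam mem unfolding repairable_family_def by (metis eq)
    thus "j = k" using g by (simp add: inj_eq)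
  next
    fix p j assume p: "p \<in> J"
    obtain q where q: "q \<in> I" "q \<noteq> h p" "w q (g j) = w (h p) (g j)"
      using fam mem[OF p] unfolding repairable_family_def by fast
    obtain q' where "q' \<in> J" "h q' = q"
      using q(1) h by (auto simp: bij_betw_def)
    thus "\<exists>q\<in>J - {p}. f (w (h q) (g j)) = f (w (h p) (g j))"
      using q by (intro bexI[of _ q']) auto
  qed
qed

text \<open>Two lines \<open>b = const\<close> of the affine plane already contain a helper for every coordinate of every
  word, so the remaining words are free to choose.\<close>

lemma repairable_family_affine:
  fixes \<beta> :: "'j \<Rightarrow> 'f::field"
  assumes \<beta>: "inj \<beta>" and S: "UNIV \<times> {0, 1} \<subseteq> S"
  shows "repairable_family S (\<lambda>(a, b) j. a + \<beta> j * b)"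
  unfolding repairable_family_def
proof (intro conjI ballI impI allI)
  fix p q j k
  assume "p \<noteq> q" and j: "(case p of (a, b) \<Rightarrow> \<lambda>j. a + \<beta> j * b) j = (case q of (a, b) \<Rightarrow> \<lambda>j. a + \<beta> j * b) j"
    and k: "(case p of (a, b) \<Rightarrow> \<lambda>j. a + \<beta> j * b) k = (case q of (a, b) \<Rightarrow> \<lambda>j. a + \<beta> j * b) k"
  obtain a b a' b' where [simp]: "p = (a, b)" "q = (a', b')" by (cases p, cases q)
  have eqs: "a + \<beta> j * b = a' + \<beta> j * b'" "a + \<beta> k * b = a' + \<beta> k * b'"
    using j k by auto
  hence "(\<beta> j - \<beta> k) * (b - b') = 0" by algebra
  moreover have "b \<noteq> b'" using eqs \<open>p \<noteq> q\<close> by auto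
  ultimately show "j = k" using \<beta> by (simp add: inj_eq)
next
  fix p j assume "p \<in> S"
  obtain a b where p: "p = (a, b)" by (cases p)
  show "\<exists>q\<in>S - {p}. (case q of (a, b) \<Rightarrow> \<lambda>j. a + \<beta> j * b) j = (case p of (a, b) \<Rightarrow> \<lambda>j. a + \<beta> j * b) j"
  \<comment> \<open>On each line \<open>b = const\<close>, coordinate \<open>j\<close> takes every
    symbol exactly once. The witnesses solve for the point with the required symbol on the line
    \<open>b = 1\<close> or \<open>b = 0\<close>, whichever avoids \<open>p\<close>.\<close>
  proof (cases "b = 0")
    case True
    thus ?thesis using S p by (intro bexI[of _ "(a - \<beta> j, 1)"]) auto
  next
    case False
    thus ?thesis using S p by (intro bexI[of _ "(a + \<beta> j * b, 0)"]) auto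
  qed
qed

text \<open>For \<open>n < 2 * CARD('f)\<close>, with \<open>r = n div 2\<close>: the constant words and the words
  \<open>(i, i + 1, i + 2, i + 3)\<close> modulo \<open>r\<close> use each symbol once each, and for odd \<open>n\<close> the word
  \<open>(0, 2, 4, 1)\<close> is added. It needs \<open>r \<ge> 5\<close>, so \<open>n = 9\<close> is treated separately.\<close>

definition cyclic_word :: "nat \<Rightarrow> nat \<Rightarrow> nat \<Rightarrow> nat" where
  "cyclic_word r p j =
     (if p < r then p else if p < 2 * r then (p - r + j) mod r else [0, 2, 4, 1] ! j)"

lemma mod_add_less:
  fixes i j r :: nat
  assumes "i < r" "j < r"
  shows "(i + j) mod r = (if i + j < r then i + j else i + j - r)"
  using assms by (simp add: mod_if)

lemma mod_add_cancel:
  fixes i j k r :: nat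
  assumes "i < r" "j < r" "k < r" "(i + j) mod r = (i + k) mod r"
  shows "j = k"
  using assms by (simp add: mod_add_less split: if_splits)

lemma mod_add_partner:
  fixes i j r :: nat
  assumes "i < r" "j < r"
  shows "\<exists>k<r. (k + j) mod r = i"
  using assms by (intro exI[of _ "if j \<le> i then i - j else i + r - j"]) auto

lemma nth_extra_word_less: "5 \<le> r \<Longrightarrow> j < 4 \<Longrightarrow> [0, 2, 4, 1] ! j < (r :: nat)"
  by (cases "j = 0"; cases "j = 1"; cases "j = 2"; cases "j = 3") auto

lemma nth_extra_word_inj:
  assumes "j < 4" "k < 4" "[0, 2, 4, 1 :: nat] ! j = [0, 2, 4, 1] ! k"
  shows "j = k"
  using nth_eq_iff_index_eq[of "[0, 2, 4, 1 :: nat]" j k] assms by simp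

text \<open>Subtracting \<open>j\<close> from entry \<open>j\<close> of \<open>(0, 2, 4, 1)\<close>
  leaves 0, 1, 2, -2 modulo \<open>r\<close>, the only shift that meets the extra word there. These
  are distinct for \<open>r >= 5\<close>, while -2 and 2 coincide for \<open>r = 4\<close>.\<close>

lemma shift_of_extra_word:
  fixes r :: nat
  assumes "i < r" "5 \<le> r" "j < 4" "(i + j) mod r = [0, 2, 4, 1] ! j"
  shows "i = [0, 1, 2, r - 2] ! j"
proof -
  have mod: "(i + j) mod r = (if i + j < r then i + j else i + j - r)"
    using assms by (intro mod_add_less) auto
  consider "j = 0" | "j = 1" | "j = 2" | "j = 3" using assms(3) by linarith
  thus ?thesis
    by cases (use assms mod in \<open>auto split: if_splits\<close>)
qed

lemma cyclic_word_less:
  assumes "4 \<le> r" "5 \<le> r \<or> p < 2 * r" "j < 4"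
  shows "cyclic_word r p j < r"
  using assms nth_extra_word_less[of r j] by (auto simp: cyclic_word_def)

text \<open>Two constant words never meet, nor do two distinct shifts. Shifts and the extra word
  have no repeated entry, so they meet a constant word at most once. A shift meets the extra word at
  most once because the four offsets of \<open>shift_of_extra_word\<close> are distinct.\<close>

lemma cyclic_word_agree_once:
  assumes r: "4 \<le> r" "5 \<le> r \<or> q < 2 * r" and pq: "p < q" "q \<le> 2 * r" and jk: "j < 4" "k < 4"
    and eq: "cyclic_word r p j = cyclic_word r q j" "cyclic_word r p k = cyclic_word r q k"
  shows "j = k"
proof -
  consider "q < r" | "p < r" "r \<le> q" "q < 2 * r" | "r \<le> p" "q < 2 * r"
    | "p < r" "q = 2 * r" "5 \<le> r" | "r \<le> p" "q = 2 * r" "5 \<le> r"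
    using r(2) pq(2) by linarith
  thus ?thesis
  proof cases
    case 1
    thus ?thesis using pq eq by (simp add: cyclic_word_def)
  next
    case 2
    thus ?thesis using r jk eq mod_add_cancel[of "q - r" r j k] by (simp add: cyclic_word_def)
  next
    case 3
    have "(j + (p - r)) mod r = (j + (q - r)) mod r"
      using 3 pq(1) eq(1) by (simp add: cyclic_word_def add.commute)
    moreover have "j < r" "p - r < r" "q - r < r" using 3 r pq jk by linarith+
    ultimately have "p - r = q - r" by (metis mod_add_cancel)
    thus ?thesis using 3 pq by linarith
  next
    case 4
    thus ?thesis using jk eq nth_extra_word_inj[of j k] by (simp add: cyclic_word_def)
  next
    case 5
    have less: "p - r < r" using 5 pq by linarith
    have shift: "p - r = [0, 1, 2, r - 2] ! i" if "i < 4" "cyclic_word r p i = cyclic_word r q i" for i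
    proof (rule shift_of_extra_word[OF less 5(3) that(1)])
      show "(p - r + i) mod r = [0, 2, 4, 1] ! i"
        using 5 pq that(2) by (simp add: cyclic_word_def)
    qed
    have "[0, 1, 2, r - 2] ! j = [0, 1, 2, r - 2] ! k"
      by (rule trans[OF sym[OF shift[OF jk(1) eq(1)]] shift[OF jk(2) eq(2)]])
    moreover have "distinct [0, 1, 2, r - 2]" using 5 by auto
    ultimately show ?thesis
      using nth_eq_iff_index_eq[of "[0, 1, 2, r - 2]" j k] jk by simp
  qed
qed

text \<open>In coordinate \<open>j\<close>, the constant word \<open>p\<close> meets the shift by
  \<open>p - j\<close> modulo \<open>r\<close>, and any other word meets the constant word of its
  own symbol.\<close>

lemma cyclic_word_partner:
  assumes r: "4 \<le> r" "5 \<le> r \<or> p < 2 * r" and j: "j < 4"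
  shows "\<exists>q<2 * r. q \<noteq> p \<and> cyclic_word r q j = cyclic_word r p j"
proof (cases "p < r")
  case True
  then obtain k where "k < r" "(k + j) mod r = p"
    using mod_add_partner[of p r j] r j by auto
  thus ?thesis using True by (intro exI[of _ "k + r"]) (auto simp: cyclic_word_def)
next
  case False
  thus ?thesis using cyclic_word_less[OF r j]
    by (intro exI[of _ "cyclic_word r p j"]) (auto simp: cyclic_word_def)
qed

lemma repairable_family_cyclic:
  fixes g :: "'j \<Rightarrow> nat"
  assumes n: "8 \<le> n" "n \<noteq> 9" and g: "inj g" "\<And>j. g j < 4"
  shows "repairable_family {..<n} (\<lambda>p j. cyclic_word (n div 2) p (g j))"
    and "p < n \<Longrightarrow> cyclic_word (n div 2) p (g i) < n div 2"
proof -
  define r where "r = n div 2"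
  have r: "4 \<le> r" "2 * r \<le> n" using n unfolding r_def by auto
  have "n \<le> 2 * r + 1" unfolding r_def by simp
  \<comment> \<open>With \<open>n = 9\<close> excluded, \<open>r = 4\<close> forces
    \<open>n = 8\<close>; hence the extra word occurs only when \<open>r >= 5\<close>.\<close>
  moreover from this n have "5 \<le> r \<or> n = 8" by linarith
  ultimately have range: "5 \<le> r \<or> p < 2 * r" "p \<le> 2 * r" if "p < n" for p
    using that r by auto
  have agree: "g j = g k" if "p < q" "q < n"
    "cyclic_word r p (g j) = cyclic_word r q (g j)" "cyclic_word r p (g k) = cyclic_word r q (g k)" for p q j k
    using cyclic_word_agree_once[OF r(1) range(1)[OF that(2)] that(1) range(2)[OF that(2)] g(2) g(2) that(3,4)] .
  show "p < n \<Longrightarrow> cyclic_word (n div 2) p (g i) < n div 2"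
    unfolding r_def[symmetric] by (rule cyclic_word_less[OF r(1) range(1) g(2)])
  show "repairable_family {..<n} (\<lambda>p j. cyclic_word (n div 2) p (g j))"
    unfolding repairable_family_def r_def[symmetric]
  proof (intro conjI ballI impI allI)
    fix p q j k
    assume "p \<in> {..<n}" "q \<in> {..<n}" "p \<noteq> q" and eq:
      "cyclic_word r p (g j) = cyclic_word r q (g j)" "cyclic_word r p (g k) = cyclic_word r q (g k)"
    consider "p < q" "q < n" | "q < p" "p < n"
      using \<open>p \<in> {..<n}\<close> \<open>q \<in> {..<n}\<close> \<open>p \<noteq> q\<close> by fastforce
    hence "g j = g k"
    proof cases
      case 1
      thus ?thesis using eq by (rule agree)
    next
      case 2
      thus ?thesis using eq[symmetric] by (rule agree)
    qed
    thus "j = k" using g(1) by (simp add: inj_eq)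
  next
    fix p j assume "p \<in> {..<n}"
    hence "p < n" by simp
    then obtain q where "q < 2 * r" "q \<noteq> p" "cyclic_word r q (g j) = cyclic_word r p (g j)"
      using cyclic_word_partner[OF r(1) range(1) g(2)] by blast
    thus "\<exists>q\<in>{..<n} - {p}. cyclic_word r q (g j) = cyclic_word r p (g j)"
      using r(2) by (intro bexI[of _ q]) auto
  qed
qed

text \<open>These are the words \<open>(x, y, x + y, x + 2 y)\<close> over the integers modulo \<open>3\<close>.\<close>

definition nine_words :: "nat \<Rightarrow> nat list" where
  "nine_words p = [p div 3, p mod 3, (p div 3 + p mod 3) mod 3, (p div 3 + 2 * (p mod 3)) mod 3]"

lemma repairable_family_nine:
  fixes g :: "'j \<Rightarrow> nat"
  assumes g: "inj g" "\<And>j. g j < 4"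
  shows "repairable_family {..<9} (\<lambda>p j. nine_words p ! g j)"
proof -
  \<comment> \<open>Quantifiers bounded by lists make this finite check executable.\<close>
  have *: "(\<forall>p\<in>set [0..<9]. \<forall>q\<in>set [0..<9]. p \<noteq> q \<longrightarrow> (\<forall>j\<in>set [0..<4]. \<forall>k\<in>set [0..<4].
          nine_words p ! j = nine_words q ! j \<longrightarrow> nine_words p ! k = nine_words q ! k \<longrightarrow> j = k)) \<and>
        (\<forall>p\<in>set [0..<9]. \<forall>j\<in>set [0..<4]. \<exists>q\<in>set [0..<9]. q \<noteq> p \<and> nine_words q ! j = nine_words p ! j)"
    by code_simp
  have once: "j = k" if "p < 9" "q < 9" "p \<noteq> q" "j < 4" "k < 4"
      "nine_words p ! j = nine_words q ! j" "nine_words p ! k = nine_words q ! k" for p q j k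
    using *[THEN conjunct1, rule_format, of p q j k] that by simp
  have partner: "\<exists>q<9. q \<noteq> p \<and> nine_words q ! j = nine_words p ! j" if "p < 9" "j < 4" for p j
    using *[THEN conjunct2, rule_format, of p j] that by auto
  show ?thesis
    unfolding repairable_family_def
  proof (intro conjI ballI impI allI)
    fix p q j k
    assume "p \<in> {..<9}" "q \<in> {..<9}" "p \<noteq> q"
      "nine_words p ! g j = nine_words q ! g j" "nine_words p ! g k = nine_words q ! g k"
    hence "g j = g k" using once[of p q "g j" "g k"] g(2) by simp
    thus "j = k" using g(1) by (simp add: inj_eq)
  next
    fix p j assume "p \<in> {..<9::nat}"
    thus "\<exists>q\<in>{..<9} - {p}. nine_words q ! g j = nine_words p ! g j"
      using partner[of p "g j"] g(2) by auto
  qed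
qed

lemma nine_words_less: "p < 9 \<Longrightarrow> j < 4 \<Longrightarrow> nine_words p ! j < 4"
  by (cases "j = 0"; cases "j = 1"; cases "j = 2"; cases "j = 3") (auto simp: nine_words_def)

text \<open>From \<open>2 * CARD('f)\<close> players on, the two affine lines fit and are filled up
  with further points of the plane. Below that, the \<open>n div 2\<close> symbols of the cyclic
  words embed in the field; nine players use the ternary words.\<close>

lemma repairable_family_exists:
  assumes "8 \<le> n" "n \<le> CARD('f) ^ 2" "4 \<le> CARD('f)"
  shows "\<exists>w :: nat \<Rightarrow> 4 \<Rightarrow> 'f::{field, finite}. repairable_family {1..n} w"
proof -
  obtain g :: "4 \<Rightarrow> nat" where "bij_betw g UNIV {0..<CARD(4)}"
    using ex_bij_betw_finite_nat[of "UNIV :: 4 set"] by auto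
  hence g: "inj g" "g j < 4" for j
    by (auto simp: bij_betw_def)
  have inj_ex: "\<exists>f :: nat \<Rightarrow> 'f. inj_on f {..<r}" if "r \<le> CARD('f)" for r
    using card_le_inj[of "{..<r}" "UNIV :: 'f set"] that by auto
  have h_ex: "\<exists>h. bij_betw h {1..n} I" if "finite I" "card I = n" for I :: "'i set"
    using that by (intro finite_same_card_bij) auto
  consider "2 * CARD('f) \<le> n" | "n < 2 * CARD('f)" "n \<noteq> 9" | "n = 9" by linarith
  thus ?thesis
  proof cases
    case 1
    obtain \<beta> :: "4 \<Rightarrow> 'f" where \<beta>: "inj \<beta>"
      using card_le_inj[of "UNIV :: 4 set" "UNIV :: 'f set"] assms(3) by auto
    let ?L = "UNIV \<times> {0, 1} :: ('f \<times> 'f) set"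
    have "card ?L \<le> n"
      using 1 by (simp add: card_cartesian_product mult.commute)
    moreover have "n \<le> CARD('f \<times> 'f)"
      using assms(2) by (simp add: power2_eq_square)
    ultimately have "\<exists>S. ?L \<subseteq> S \<and> S \<subseteq> UNIV \<and> card S = n"
      by (rule exists_subset_between) simp_all
    then obtain S where S: "?L \<subseteq> S" "card S = n" by blast
    obtain h where "bij_betw h {1..n} S" using h_ex[OF finite S(2)] ..
    hence "repairable_family {1..n} (\<lambda>p j. (\<lambda>(a, b) j. a + \<beta> j * b) (h p) j)"
      by (rule repairable_family_transfer[OF repairable_family_affine[OF \<beta> S(1)] _
            inj_on_id2[of UNIV] inj_on_id2 UNIV_I])
    thus ?thesis by blast
  next
    case 2
    have "n div 2 \<le> CARD('f)" using 2(1) by simp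
    then obtain f :: "nat \<Rightarrow> 'f" where f: "inj_on f {..<n div 2}" using inj_ex by blast
    obtain h where h: "bij_betw h {1..n} {..<n}" using h_ex[OF finite_lessThan card_lessThan] ..
    have "cyclic_word (n div 2) p (g j) \<in> {..<n div 2}" if "p \<in> {..<n}" for p j
      using repairable_family_cyclic(2)[OF assms(1) 2(2) g] that by simp
    hence "repairable_family {1..n} (\<lambda>p j. f (cyclic_word (n div 2) (h p) (g j)))"
      by (rule repairable_family_transfer[OF repairable_family_cyclic(1)[OF assms(1) 2(2) g] h f
            inj_on_id2])
    thus ?thesis by blast
  next
    case 3
    obtain f :: "nat \<Rightarrow> 'f" where f: "inj_on f {..<4}"
      using inj_ex[OF assms(3)] ..
    have "card {..<9::nat} = n" using 3 by simp
    then obtain h where h: "bij_betw h {1..n} {..<9::nat}" using h_ex[OF finite_lessThan] by blast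
    have "nine_words p ! g j \<in> {..<4}" if "p \<in> {..<9}" for p j
      using nine_words_less g(2) that by simp
    hence "repairable_family {1..n} (\<lambda>p j. f (nine_words (h p) ! g j))"
      by (rule repairable_family_transfer[OF repairable_family_nine[OF g] h f inj_on_id2])
    thus ?thesis by blast
  qed
qed

section \<open>Arithmetic of the parameters and assembly of the scheme\<close>

theorem theorem5p2:
  fixes m n Q :: nat
  assumes "m > 0" and "[m = 4] (mod 12)"
    and "primepow Q" and "CARD('f::{field, finite}) = Q" and "Q \<ge> m + 1"
    and "real m / 2 \<le> real n" and "real n \<le> real m * (real m - 1) / 12"
  shows "\<exists>(K :: nat set) (deal :: nat \<Rightarrow> (nat \<Rightarrow> 'f ^ 4) pmf) (helpers :: nat \<Rightarrow> nat set)
            (prot :: nat \<Rightarrow> ('f ^ 4, nat, nat) repair_protocol).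
           restricted_RTS 2 n 4 K UNIV deal helpers prot \<and>
           information_rate K (UNIV :: ('f ^ 4) set) = 3 / 4 \<and>
           (\<forall>l\<in>{1..n}. communication_complexity K deal l (helpers l) (prot l) = 4 / 3)"
proof -
  have "m mod 12 = 4" using assms(2) by (simp add: Cong.cong_def)
  \<comment> \<open>For \<open>m = 4\<close> the bounds would read \<open>2 <= n <= 1\<close>. The
    next value 16 gives \<open>n >= 8\<close> and \<open>Q >= 17\<close>.\<close>
  moreover have "m \<noteq> 4" using assms(6,7) by auto
  ultimately have m: "16 \<le> m" by presburger
  have n8: "8 \<le> n" using assms(6) m by linarith
  \<comment> \<open>A crude bound is enough, since the existence of words asks only for
    \<open>n <= Q^2\<close>.\<close>
  have "real m * (real m - 1) / 12 \<le> real m * real m"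
    by (simp add: field_simps)
  hence "real n \<le> real (m * m)" using assms(7) by simp
  hence "n \<le> m * m" by (simp only: of_nat_le_iff)
  also have "\<dots> \<le> Q * Q" using assms(5) by (intro mult_mono) auto
  finally have "n \<le> CARD('f) ^ 2" by (simp add: assms(4) power2_eq_square)
  hence "\<exists>w :: nat \<Rightarrow> 4 \<Rightarrow> 'f. repairable_family {1..n} w"
    using n8 m assms(4,5) by (intro repairable_family_exists) auto
  then obtain w :: "nat \<Rightarrow> 4 \<Rightarrow> 'f" where w: "repairable_family {1..n} w" ..
  then obtain helper where helper:
    "\<And>l j. l \<in> {1..n} \<Longrightarrow> helper l j \<in> {1..n} - {l} \<and> w (helper l j) j = w l j"
    unfolding repairable_family_def by metis
  let ?C = "parity_code :: ('f ^ 4) set"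
  \<comment> \<open>Secrets number the \<open>Q^3\<close> codewords, whereas shares range over
    \<open>Q^4\<close> words.\<close>
  obtain codeword where codeword: "bij_betw codeword {0..<card ?C} ?C"
    using ex_bij_betw_nat_finite[of ?C] by auto
  obtain enc :: "'f \<Rightarrow> nat" where enc: "inj enc"
    using finite_imp_inj_to_nat_seg[of "UNIV :: 'f set"] by auto
  interpret word_scheme n w helper "{0..<card ?C}" codeword enc
  proof
    show "j = k" if "p \<in> {1..n}" "q \<in> {1..n}" "p \<noteq> q" "w p j = w q j" "w p k = w q k" for p q j k
      using w that unfolding repairable_family_def by blast
  qed (use n8 helper codeword enc in auto)
  show ?thesis
    using restricted_RTS_prot information_rate_deal communication_complexity_prot
    by (intro exI[of _ "{0..<card ?C}"] exI[of _ deal] exI[of _ "\<lambda>l. range (helper l)"] exI[of _ prot])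
      auto
qed

end
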